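(* Let $r\ge 0$, $k\ge 3$ and $m\ge r+k$ be integers, let $g=m-(r+k)$, and suppose there exists a $(g+1)\text{-}(m,g+2,k-1)$ design in which no block appears more than $k-2$ times. If $n$ is an integer with $$\frac{k-1}{r+k-1}\binom{m}{r+k-2}\le n\le (k-1)\binom{m}{r+k-1},$$ then $$N(n,k,m;r)=(r+k-1)n-\left\lfloor\frac{(k-1)\binom{m}{r+k-1}-n}{m-r-k+1}\right\rfloor.$$
   Context: For a nonnegative integer $s$, $[s]=\{1,\dots,s\}$. An $r\text{-ECBC}(n,k,m)$ (erasure combinatorial batch code with redundancy $r$, with at most one item read from each server) is a multifamily $\mathcal{B}=\{B_1,\dots,B_m\}$ of $m$ subsets of $[n]$ such that for each $Y\subseteq[n]$ with $|Y|\le k$ and each $J\subseteq[m]$ with $|J|\ge m-r$ there exist subsets $C_j\subseteq B_j$ ($j\in J$) with $|C_j|\le 1$ and $Y=\bigcup_{j\in J}C_j$. The parameters are always assumed to satisfy $r<m$ and $1\le k\le\min\{n,m-r\}$. Its weight is $N(\mathcal{B})=|B_1|+\cdots+|B_m|$. $N(n,k,m;r)$ denotes the minimum weight of an $r\text{-ECBC}(n,k,m)$. A $t\text{-}(v,\kappa,\lambda)$ design is a pair $(X,\mathcal{D})$ where $X$ is a set with $|X|=v$ and $\mathcal{D}$ is a family (repetitions allowed) of subsets of $X$, called blocks, each of cardinality $\kappa$, such that each $t$-subset of $X$ is contained in exactly $\lambda$ blocks, counted with multiplicity. *)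

theory Defs
  imports Complex_Main "HOL-Library.Multiset"
begin

text \<open>
  The multifamily is indexed by \<open>{1..m}\<close>; values of \<open>B\<close> outside this range are irrelevant.
  At most one item is read from each server, hence \<open>card (C j) \<le> 1\<close>.
\<close>

definition is_ECBC :: "nat \<Rightarrow> nat \<Rightarrow> nat \<Rightarrow> nat \<Rightarrow> (nat \<Rightarrow> nat set) \<Rightarrow> bool" where
  "is_ECBC r n k m B \<longleftrightarrow>
     (\<forall>j\<in>{1..m}. B j \<subseteq> {1..n}) \<and>
     (\<forall>Y J. Y \<subseteq> {1..n} \<and> card Y \<le> k \<and> J \<subseteq> {1..m} \<and> m - r \<le> card J \<longrightarrow>
        (\<exists>C. (\<forall>j\<in>J. C j \<subseteq> B j \<and> card (C j) \<le> 1) \<and> Y = (\<Union>j\<in>J. C j)))"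

definition ECBC_weight :: "nat \<Rightarrow> (nat \<Rightarrow> nat set) \<Rightarrow> nat" where
  "ECBC_weight m B = (\<Sum>j\<in>{1..m}. card (B j))"

text \<open>
  The minimum is over a nonempty set whenever \<open>r < m\<close> and \<open>1 \<le> k \<le> min n (m - r)\<close>:
  storing all of \<open>{1..n}\<close> on every server is then a valid code.
\<close>

definition ECBC_min_weight :: "nat \<Rightarrow> nat \<Rightarrow> nat \<Rightarrow> nat \<Rightarrow> nat" where
  "ECBC_min_weight n k m r = (LEAST w. \<exists>B. is_ECBC r n k m B \<and> ECBC_weight m B = w)"

definition is_design :: "nat \<Rightarrow> nat \<Rightarrow> nat \<Rightarrow> nat \<Rightarrow> 'a set \<Rightarrow> 'a set multiset \<Rightarrow> bool" where
  "is_design t v \<kappa> l X D \<longleftrightarrow>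
     finite X \<and> card X = v \<and>
     (\<forall>b\<in>#D. b \<subseteq> X \<and> card b = \<kappa>) \<and>
     (\<forall>T. T \<subseteq> X \<and> card T = t \<longrightarrow> size {#b \<in># D. T \<subseteq> b#} = l)"

end

theory Submission imports Defs
begin

text \<open>
  Read a code backwards: each item is stored on a set of servers, so the code is a multiset \<open>M\<close> of
  \<open>n\<close> subsets of \<open>{1..m}\<close>, and its weight is the sum of their cardinalities. After an erasure of
  \<open>r\<close> servers, retrieving a set of items, one item per server, means choosing distinct surviving
  servers for them. By Hall's theorem (\<open>hall_marriage\<close>) this always succeeds iff any \<open>i + 1 \<le> k\<close>
  items occupy at least \<open>r + i + 1\<close> servers; equivalently, no \<open>r + i\<close> servers with \<open>i < k\<close> contain
  more than \<open>i\<close> members of \<open>M\<close>. This is the predicate \<open>sparse\<close>, and \<open>ECBC_iff_sparse\<close> is the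
  resulting reformulation. Write \<open>s = r + k - 1\<close>.

  Lower bound (\<open>sparse_weight_bound\<close>): each of the \<open>m choose s\<close> sets of \<open>s\<close> servers contains at
  most \<open>k - 1\<close> members of \<open>M\<close>. A member \<open>a\<close> lies in at least \<open>1 + (m - s) (s - card a)\<close> such sets,
  because \<open>(b + j) choose j \<ge> 1 + j b\<close>; the claim is trivial when
  \<open>card a > s\<close>. Counting the incidences twice gives
  \<open>n + (m - s) (s n - w) \<le> (k - 1) (m choose s)\<close> for the weight \<open>w\<close>, and integrality of \<open>s n - w\<close>
  yields the claimed value as a lower bound.

  Upper bound (\<open>sparse_extension\<close>): the estimate is exact for members of size \<open>s\<close> and \<open>s - 1\<close>,
  so the aim is to use only these, with as many as possible of size \<open>s - 1\<close>. The complements of the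
  blocks of the design have size \<open>s - 1\<close>, and every \<open>s\<close>-set contains exactly \<open>k - 1\<close> of them
  (\<open>design_complement\<close>). Keep \<open>t\<close> of them, where \<open>t\<close> is the rounded quotient, and use copies of
  \<open>s\<close>-sets as remaining members, each \<open>s\<close>-set at most as often as its bound \<open>k - 1\<close> still permits.
  The multiplicity bound \<open>k - 2\<close> on blocks is precisely sparseness for sets of size \<open>s - 1\<close>; the
  lower bound on \<open>n\<close> says that \<open>n\<close> is at least the number of blocks, and this is what makes
  \<open>t\<close> blocks available.
\<close>

section \<open>Hall's marriage theorem\<close>

text \<open>
  Induction on the size of the index set. If some proper nonempty subfamily has a union of exactly its
  own size, then it uses up that union, and the rest still satisfies the condition after the union is
  removed. Otherwise every proper nonempty subfamily has one element to spare, so one representative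
  can be chosen freely.
\<close>

lemma hall_marriage:
  assumes "finite I" and "\<And>i. i \<in> I \<Longrightarrow> finite (A i)"
    and "\<And>K. K \<subseteq> I \<Longrightarrow> card K \<le> card (\<Union>(A ` K))"
  shows "\<exists>f. inj_on f I \<and> (\<forall>i\<in>I. f i \<in> A i)"
  using assms
proof (induction "card I" arbitrary: I A rule: less_induct)
  case less
  note fin = less.prems(1,2) and hall = less.prems(3)
  have fin_un: "finite (\<Union>(A ` K))" if "K \<subseteq> I" for K
    using fin that by (meson finite_UN_I finite_subset subsetD)
  show ?case
  proof (cases "\<exists>K. K \<subset> I \<and> K \<noteq> {} \<and> card K = card (\<Union>(A ` K))")
    case True
    then obtain K where K: "K \<subset> I" "K \<noteq> {}" "card K = card (\<Union>(A ` K))" by blast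
    have finK: "finite K" using K fin by (meson finite_subset psubset_imp_subset)
    let ?A = "\<lambda>i. A i - \<Union>(A ` K)"
    have "\<exists>f. inj_on f K \<and> (\<forall>i\<in>K. f i \<in> A i)"
      using less.hyps[of K A] K fin hall finK psubset_card_mono[of I K] by auto
    then obtain f where f: "inj_on f K" "\<forall>i\<in>K. f i \<in> A i" by blast
    have "\<exists>f. inj_on f (I - K) \<and> (\<forall>i\<in>I - K. f i \<in> ?A i)"
    proof (rule less.hyps)
      show "card (I - K) < card I"
        using K fin by (intro psubset_card_mono) auto
      show "finite (I - K)" "\<And>i. i \<in> I - K \<Longrightarrow> finite (?A i)" using fin by auto
      fix L assume L: "L \<subseteq> I - K"
      have "finite L" using L fin(1) by (meson Diff_subset finite_subset)
      then have "card L + card K = card (L \<union> K)"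
        using L finK by (intro card_Un_disjoint[symmetric]) auto
      also have "\<dots> \<le> card (\<Union>(A ` (L \<union> K)))" using L K by (intro hall) auto
      also have "\<dots> = card (\<Union>(?A ` L) \<union> \<Union>(A ` K))"
        by (rule arg_cong[of _ _ card]) auto
      also have "\<dots> \<le> card (\<Union>(?A ` L)) + card (\<Union>(A ` K))" by (rule card_Un_le)
      finally show "card L \<le> card (\<Union>(?A ` L))" using K by simp
    qed
    then obtain h where h: "inj_on h (I - K)" "\<forall>i\<in>I - K. h i \<in> ?A i" by blast
    let ?f = "\<lambda>i. if i \<in> K then f i else h i"
    have apart: "f i \<noteq> h j" if "i \<in> K" "j \<in> I - K" for i j
    proof -
      have "f i \<in> \<Union>(A ` K)" using f(2) that(1) by (intro UN_I[of i]) auto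
      moreover have "h j \<notin> \<Union>(A ` K)" using h(2) that(2) by (metis DiffD2)
      ultimately show ?thesis by metis
    qed
    have "inj_on ?f I"
    proof (rule inj_onI)
      fix i j assume "i \<in> I" "j \<in> I" "?f i = ?f j"
      then show "i = j"
        using apart[of i j] apart[of j i] inj_onD[OF f(1), of i j] inj_onD[OF h(1), of i j]
        by (cases "i \<in> K"; cases "j \<in> K") auto
    qed
    moreover have "\<forall>i\<in>I. ?f i \<in> A i" using f h by auto
    ultimately show ?thesis by blast
  next
    case not_tight: False
    show ?thesis
    proof (cases "I = {}")
      case True
      then show ?thesis by simp
    next
      case False
      then obtain i where i: "i \<in> I" by blast
      have "card {i} \<le> card (\<Union>(A ` {i}))" using i by (intro hall) auto
      then have "A i \<noteq> {}" by auto
      then obtain a where a: "a \<in> A i" by blast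
      let ?A = "\<lambda>j. A j - {a}"
      have "\<exists>f. inj_on f (I - {i}) \<and> (\<forall>j\<in>I - {i}. f j \<in> ?A j)"
      proof (rule less.hyps)
        show "card (I - {i}) < card I" using i fin by (meson card_Diff1_less)
        show "finite (I - {i})" "\<And>j. j \<in> I - {i} \<Longrightarrow> finite (?A j)" using fin by auto
        fix L assume L: "L \<subseteq> I - {i}"
        show "card L \<le> card (\<Union>(?A ` L))"
        proof (cases "L = {}")
          case False
          have "L \<subset> I" using L i by auto
          with False have "card L \<noteq> card (\<Union>(A ` L))" using not_tight by blast
          with hall[OF psubset_imp_subset[OF \<open>L \<subset> I\<close>]] have "card L < card (\<Union>(A ` L))" by simp
          also have "\<dots> \<le> card (insert a (\<Union>(?A ` L)))"
          proof (rule card_mono)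
            have "insert a (\<Union>(?A ` L)) \<subseteq> insert a (\<Union>(A ` L))" by blast
            then show "finite (insert a (\<Union>(?A ` L)))"
              by (rule finite_subset) (use fin_un[of L] \<open>L \<subset> I\<close> in simp)
          qed blast
          also have "\<dots> \<le> Suc (card (\<Union>(?A ` L)))" 
            using card_Un_le[of "{a}" "\<Union>(?A ` L)"] by simp
          finally show ?thesis by simp
        qed simp
      qed
      then obtain f where f: "inj_on f (I - {i})" "\<forall>j\<in>I - {i}. f j \<in> ?A j" by blast
      have "inj_on (f(i := a)) I" using f unfolding inj_on_def by auto
      moreover have "\<forall>j\<in>I. (f(i := a)) j \<in> A j" using f a by auto
      ultimately show ?thesis by blast
    qed
  qed
qed

section \<open>Codes as sparse multisets of server sets\<close>

definition servers :: "nat \<Rightarrow> (nat \<Rightarrow> nat set) \<Rightarrow> nat \<Rightarrow> nat set" where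
  "servers m B x = {j \<in> {1..m}. x \<in> B j}"

definition sparse :: "nat \<Rightarrow> nat \<Rightarrow> nat \<Rightarrow> nat set multiset \<Rightarrow> bool" where
  "sparse r k m M \<longleftrightarrow>
     (\<forall>a\<in>#M. a \<subseteq> {1..m}) \<and>
     (\<forall>i<k. \<forall>S\<subseteq>{1..m}. card S = r + i \<longrightarrow> size {#a \<in># M. a \<subseteq> S#} \<le> i)"

lemma double_count_mset:
  assumes "finite F"
  shows "(\<Sum>S\<in>F. size {#a \<in># M. P a S#}) = (\<Sum>a\<in>#M. card {S \<in> F. P a S})"
proof (induction M)
  case (add a M)
  have "(\<Sum>S\<in>F. size {#b \<in># add_mset a M. P b S#})
      = (\<Sum>S\<in>F. (if P a S then 1 else 0) + size {#b \<in># M. P b S#})"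
    by (rule sum.cong) auto
  also have "\<dots> = card {S \<in> F. P a S} + (\<Sum>a\<in>#M. card {S \<in> F. P a S})"
    using assms by (simp add: sum.distrib add.IH sum.If_cases Int_def)
  finally show ?case by simp
qed simp

lemma ECBC_weight_servers:
  assumes "\<forall>j\<in>{1..m}. B j \<subseteq> {1..n}"
  shows "ECBC_weight m B = (\<Sum>x\<in>{1..n}. card (servers m B x))"
proof -
  have "ECBC_weight m B = (\<Sum>j\<in>{1..m}. \<Sum>x\<in>{1..n}. if x \<in> B j then 1 else 0)"
    unfolding ECBC_weight_def
  proof (rule sum.cong)
    fix j assume "j \<in> {1..m}"
    then have "{x \<in> {1..n}. x \<in> B j} = B j" using assms by blast
    then show "card (B j) = (\<Sum>x\<in>{1..n}. if x \<in> B j then 1 else 0)"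
      by (simp add: sum.If_cases Int_def)
  qed simp
  also have "\<dots> = (\<Sum>x\<in>{1..n}. \<Sum>j\<in>{1..m}. if x \<in> B j then 1 else 0)" by (rule sum.swap)
  also have "\<dots> = (\<Sum>x\<in>{1..n}. card (servers m B x))"
    by (simp add: sum.If_cases Int_def servers_def)
  finally show ?thesis .
qed

text \<open>
  Let the erased servers be \<open>r\<close> members of \<open>S\<close>. Items stored only within \<open>S\<close> then have just \<open>i\<close>
  servers left, each delivering one item, so \<open>i + 1\<close> such items could not all be retrieved.
\<close>

lemma ECBC_few_items_in_small_set:
  assumes B: "is_ECBC r n k m B" and "r + k \<le> m" and i: "i < k"
    and S: "S \<subseteq> {1..m}" "card S = r + i"
  shows "card {x \<in> {1..n}. servers m B x \<subseteq> S} \<le> i"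
proof (rule ccontr)
  assume "\<not> ?thesis"
  then have "i + 1 \<le> card {x \<in> {1..n}. servers m B x \<subseteq> S}" by simp
  then obtain Y where Y: "Y \<subseteq> {x \<in> {1..n}. servers m B x \<subseteq> S}" "card Y = i + 1"
    by (rule obtain_subset_with_card_n)
  have "r \<le> card S" using S(2) by simp
  then obtain R where R: "R \<subseteq> S" "card R = r" by (rule obtain_subset_with_card_n)
  have finS: "finite S" and finR: "finite R"
    using S(1) R(1) finite_subset[of S "{1..m}"] finite_subset[of R S] by auto
  have "card ({1..m} - R) = m - r"
    using R S(1) finR by (subst card_Diff_subset) auto
  moreover have "Y \<subseteq> {1..n}" "card Y \<le> k" using Y i by auto
  ultimately have "\<exists>C. (\<forall>j\<in>{1..m} - R. C j \<subseteq> B j \<and> card (C j) \<le> 1) \<and> Y = (\<Union>j\<in>{1..m} - R. C j)"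
    using B[unfolded is_ECBC_def, THEN conjunct2, rule_format, of Y "{1..m} - R"] by simp
  then obtain C where C: "\<forall>j\<in>{1..m} - R. C j \<subseteq> B j \<and> card (C j) \<le> 1"
      "Y = (\<Union>j\<in>{1..m} - R. C j)" by blast
  have "Y \<subseteq> (\<Union>j\<in>S - R. C j)"
  proof
    fix x assume x: "x \<in> Y"
    then obtain j where j: "j \<in> {1..m} - R" "x \<in> C j" using C(2) by blast
    then have "j \<in> servers m B x" using C(1) unfolding servers_def by auto
    then show "x \<in> (\<Union>j\<in>S - R. C j)" using Y(1) x j by blast
  qed
  moreover have "finite (\<Union>j\<in>S - R. C j)"
  proof (rule finite_subset)
    show "(\<Union>j\<in>S - R. C j) \<subseteq> Y" using S(1) C(2) by blast
    show "finite Y" using Y(2) by (simp add: card_ge_0_finite)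
  qed
  ultimately have "card Y \<le> card (\<Union>j\<in>S - R. C j)" by (rule card_mono[rotated])
  also have "\<dots> \<le> (\<Sum>j\<in>S - R. card (C j))" using finS by (intro card_UN_le) auto
  also have "\<dots> \<le> (\<Sum>j\<in>S - R. 1)" using C(1) S(1) by (intro sum_mono) auto
  also have "\<dots> = i" using S(2) R finR by (simp add: card_Diff_subset)
  finally show False using Y(2) by simp
qed

text \<open>
  If \<open>i + 1\<close> items occupied at most \<open>r + i\<close> servers, then these servers, enlarged to a set of size
  \<open>r + i\<close>, would contain too many items. So Hall's condition holds with a surplus of \<open>r\<close>, and it
  survives the loss of \<open>r\<close> servers.
\<close>

lemma ECBC_if_few_items_in_small_sets:
  assumes B: "\<forall>j\<in>{1..m}. B j \<subseteq> {1..n}" and rk: "r + k \<le> m"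
    and few: "\<And>i S. i < k \<Longrightarrow> S \<subseteq> {1..m} \<Longrightarrow> card S = r + i \<Longrightarrow>
      card {x \<in> {1..n}. servers m B x \<subseteq> S} \<le> i"
  shows "is_ECBC r n k m B"
  unfolding is_ECBC_def
proof (intro conjI allI impI)
  show "\<forall>j\<in>{1..m}. B j \<subseteq> {1..n}" by (rule B)
  fix Y J assume asm: "Y \<subseteq> {1..n} \<and> card Y \<le> k \<and> J \<subseteq> {1..m} \<and> m - r \<le> card J"
  let ?A = "servers m B"
  have finA: "finite (?A x)" and subA: "?A x \<subseteq> {1..m}" for x unfolding servers_def by auto
  have finY: "finite Y" and finJ: "finite J"
    using asm finite_subset[of Y "{1..n}"] finite_subset[of J "{1..m}"] by auto
  have spread: "r + card K \<le> card (\<Union>(?A ` K))" if K: "K \<subseteq> Y" "K \<noteq> {}" for K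
  proof (rule ccontr)
    assume *: "\<not> ?thesis"
    have finK: "finite K" using K(1) finY by (rule finite_subset)
    then have "card K \<ge> 1" using K by (simp add: Suc_leI card_gt_0_iff)
    then obtain i where i: "card K = i + 1" using nat_le_iff_add[of 1 "card K"] by auto
    have ik: "i < k" using i asm card_mono[OF finY K(1)] by simp
    have "\<exists>S. \<Union>(?A ` K) \<subseteq> S \<and> S \<subseteq> {1..m} \<and> card S = r + i"
      using * i ik rk subA by (intro exists_subset_between) auto
    then obtain S where S: "\<Union>(?A ` K) \<subseteq> S" "S \<subseteq> {1..m}" "card S = r + i" by blast
    have "card K \<le> card {x \<in> {1..n}. ?A x \<subseteq> S}" using K asm S by (intro card_mono) auto
    with few[OF ik S(2,3)] i show False by simp
  qed
  have "\<exists>f. inj_on f Y \<and> (\<forall>x\<in>Y. f x \<in> ?A x \<inter> J)"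
  proof (rule hall_marriage)
    show "finite Y" by (rule finY)
    show "finite (?A x \<inter> J)" for x using finA by simp
    fix K assume K: "K \<subseteq> Y"
    show "card K \<le> card (\<Union>x\<in>K. ?A x \<inter> J)"
    proof (cases "K = {}")
      case False
      let ?U = "\<Union>(?A ` K)"
      have U: "?U \<subseteq> {1..m}" using subA by blast
      have "r + card K \<le> card ?U" using spread K False by blast
      also have "\<dots> \<le> card ((?U \<inter> J) \<union> ({1..m} - J))"
        using U by (intro card_mono) (auto simp: finJ)
      also have "\<dots> \<le> card (?U \<inter> J) + card ({1..m} - J)" by (rule card_Un_le)
      also have "card ({1..m} - J) = m - card J" using asm finJ by (simp add: card_Diff_subset)
      also have "m - card J \<le> r" using asm rk by linarith
      finally have "card K \<le> card (?U \<inter> J)" by simp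
      moreover have "(\<Union>x\<in>K. ?A x \<inter> J) = ?U \<inter> J" by blast
      ultimately show ?thesis by simp
    qed simp
  qed
  then obtain f where f: "inj_on f Y" "\<forall>x\<in>Y. f x \<in> ?A x \<inter> J" by blast
  have "card {x \<in> Y. f x = j} \<le> 1" for j
    using f(1) by (auto simp: card_le_Suc0_iff_eq finY inj_on_def)
  moreover have "{x \<in> Y. f x = j} \<subseteq> B j" for j using f(2) unfolding servers_def by auto
  moreover have "Y = (\<Union>j\<in>J. {x \<in> Y. f x = j})" using f(2) by auto
  ultimately show "\<exists>C. (\<forall>j\<in>J. C j \<subseteq> B j \<and> card (C j) \<le> 1) \<and> Y = (\<Union>j\<in>J. C j)"
    by (intro exI[of _ "\<lambda>j. {x \<in> Y. f x = j}"]) auto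
qed

text \<open>
  Sparseness depends only on the multiset of server sets, and any multiset of \<open>n\<close> server sets comes
  from a code: enumerate it and store item \<open>x\<close> on the servers of its \<open>x\<close>-th entry. The extremal
  problem can therefore be treated without naming the items.
\<close>

lemma ECBC_iff_sparse:
  assumes "r + k \<le> m"
  shows "(\<exists>B. is_ECBC r n k m B \<and> ECBC_weight m B = w) \<longleftrightarrow>
         (\<exists>M. sparse r k m M \<and> size M = n \<and> (\<Sum>a\<in>#M. card a) = w)"
proof (intro iffI; elim exE conjE)
  fix B assume B: "is_ECBC r n k m B" and w: "ECBC_weight m B = w"
  let ?M = "image_mset (servers m B) (mset_set {1..n})"
  have "sparse r k m ?M"
    using ECBC_few_items_in_small_set[OF B assms] unfolding sparse_def
    by (auto simp: servers_def filter_mset_image_mset)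
  moreover have "(\<Sum>a\<in>#?M. card a) = w"
    using w B ECBC_weight_servers[of m B n]
    by (simp add: is_ECBC_def multiset.map_comp comp_def sum_unfold_sum_mset)
  ultimately show "\<exists>M. sparse r k m M \<and> size M = n \<and> (\<Sum>a\<in>#M. card a) = w"
    by (intro exI[of _ ?M]) simp
next
  fix M assume M: "sparse r k m M" and n: "size M = n" and w: "(\<Sum>a\<in>#M. card a) = w"
  obtain xs where xs: "mset xs = M" using ex_mset by blast
  have len: "length xs = n" using xs n by auto
  \<comment> \<open>Items are numbered from 1, list positions from 0.\<close>
  define B where "B j = {x \<in> {1..n}. j \<in> xs ! (x - 1)}" for j
  have serv: "servers m B x = xs ! (x - 1)" if "x \<in> {1..n}" for x
  proof -
    have "xs ! (x - 1) \<in># M" using that len xs by (auto simp flip: xs)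
    then have "xs ! (x - 1) \<subseteq> {1..m}" using M unfolding sparse_def by blast
    then show ?thesis using that unfolding servers_def B_def by auto
  qed
  have shift: "mset_set {1..n} = image_mset Suc (mset_set {0..<n})"
    by (simp add: image_mset_mset_set image_Suc_atLeastLessThan atLeastLessThanSuc_atLeastAtMost)
  have "image_mset (servers m B) (mset_set {1..n}) = image_mset (\<lambda>x. xs ! (x - 1)) (mset_set {1..n})"
    using serv by (intro image_mset_cong) auto
  also have "\<dots> = mset (map (\<lambda>x. xs ! x) [0..<length xs])"
    unfolding shift by (simp add: multiset.map_comp comp_def len)
  also have "\<dots> = M" by (simp only: map_nth xs)
  finally have eq: "image_mset (servers m B) (mset_set {1..n}) = M" .
  have sub: "\<forall>j\<in>{1..m}. B j \<subseteq> {1..n}" unfolding B_def by auto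
  have "is_ECBC r n k m B"
  proof (rule ECBC_if_few_items_in_small_sets[OF sub assms])
    fix i S assume "i < k" "S \<subseteq> {1..m}" "card S = r + i"
    then have "size {#a \<in># M. a \<subseteq> S#} \<le> i" using M unfolding sparse_def by blast
    then show "card {x \<in> {1..n}. servers m B x \<subseteq> S} \<le> i"
      by (simp add: filter_mset_image_mset flip: eq)
  qed
  moreover have "ECBC_weight m B = w"
    unfolding ECBC_weight_servers[OF sub] w[symmetric]
    by (simp add: multiset.map_comp comp_def sum_unfold_sum_mset flip: eq)
  ultimately show "\<exists>B. is_ECBC r n k m B \<and> ECBC_weight m B = w" by blast
qed

section \<open>Counting containing sets\<close>

lemma card_supersets_of_card:
  assumes V: "finite V" and A: "A \<subseteq> V" "card A \<le> s"
  shows "card {S \<in> {S. S \<subseteq> V \<and> card S = s}. A \<subseteq> S} = (card V - card A) choose (s - card A)"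
proof -
  have finA: "finite A" using A(1) V by (rule finite_subset)
  have "bij_betw (\<lambda>T. T \<union> A) {T. T \<subseteq> V - A \<and> card T = s - card A}
      {S \<in> {S. S \<subseteq> V \<and> card S = s}. A \<subseteq> S}"
  proof (rule bij_betw_byWitness[where f' = "\<lambda>S. S - A"])
    show "(\<lambda>T. T \<union> A) ` {T. T \<subseteq> V - A \<and> card T = s - card A}
        \<subseteq> {S \<in> {S. S \<subseteq> V \<and> card S = s}. A \<subseteq> S}"
    proof (rule image_subsetI)
      fix T assume "T \<in> {T. T \<subseteq> V - A \<and> card T = s - card A}"
      then have T: "T \<subseteq> V - A" "card T = s - card A" by auto
      have "card (T \<union> A) = card T + card A"
        using T finA finite_subset[OF T(1)] V by (intro card_Un_disjoint) auto
      then show "T \<union> A \<in> {S \<in> {S. S \<subseteq> V \<and> card S = s}. A \<subseteq> S}" using T A by auto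
    qed
    show "(\<lambda>S. S - A) ` {S \<in> {S. S \<subseteq> V \<and> card S = s}. A \<subseteq> S}
        \<subseteq> {T. T \<subseteq> V - A \<and> card T = s - card A}"
      using finA by (auto simp: card_Diff_subset)
  qed auto
  then show ?thesis
    using V A finA by (simp add: bij_betw_same_card[symmetric] n_subsets card_Diff_subset)
qed

lemma Suc_mult_le_binomial: "1 + t * a \<le> (a + t) choose t"
proof (induction a)
  case (Suc a)
  show ?case
  proof (cases t)
    case (Suc u)
    have "Suc u choose u \<le> (a + Suc u) choose u" by (rule binomial_right_mono) simp
    then show ?thesis using Suc.IH Suc by (simp add: binomial_Suc_n)
  qed simp
qed simp

section \<open>The lower bound\<close>

text \<open>
  The incidences between the members \<open>a\<close> of \<open>M\<close> and the \<open>s\<close>-sets containing them are counted twice.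
  The statement is over the integers because a member with more than \<open>s\<close> elements makes
  \<open>s - card a\<close> negative.
\<close>

lemma sparse_weight_bound:
  assumes M: "sparse r k m M" and k: "k \<ge> 1" and rk: "r + k \<le> m" and s: "s = r + k - 1"
  shows "int (size M) + (int m - int s) * (int s * int (size M) - int (\<Sum>a\<in>#M. card a))
      \<le> (int k - 1) * int (m choose s)"
proof -
  let ?F = "{S. S \<subseteq> {1..m} \<and> card S = s}"
  have ms: "s < m" using rk k s by simp
  have one: "1 + (int m - int s) * (int s - int (card a)) \<le> int (card {S \<in> ?F. a \<subseteq> S})"
    if a: "a \<subseteq> {1..m}" for a
  proof (cases "card a \<le> s")
    case True
    then obtain t where t: "s = card a + t" using le_Suc_ex by blast
    obtain b where b: "m = s + b" using ms le_Suc_ex less_imp_le by blast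
    have "card {S \<in> ?F. a \<subseteq> S} = (b + t) choose t"
      using card_supersets_of_card[of "{1..m}" a s] a True t b by (simp add: add.commute)
    then show ?thesis
      using Suc_mult_le_binomial[of t b] t b
      by (simp add: mult.commute flip: of_nat_mult of_nat_Suc)
  next
    case False
    \<comment> \<open>No \<open>s\<close>-set contains \<open>a\<close>, but as \<open>m > s\<close> the left-hand side is not positive either.\<close>
    then have "(int m - int s) * (int s - int (card a)) \<le> 1 * (-1)"
      using ms mult_mono[of 1 "int m - int s" 1 "int (card a) - int s"]
      by (simp add: algebra_simps)
    then show ?thesis by simp
  qed
  have "int (size M) + (int m - int s) * (int s * int (size M) - int (\<Sum>a\<in>#M. card a))
      \<le> int (\<Sum>a\<in>#M. card {S \<in> ?F. a \<subseteq> S})"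
    using M[unfolded sparse_def, THEN conjunct1]
  proof (induction M)
    case (add a M)
    then show ?case using one[of a] by (simp add: algebra_simps)
  qed simp
  also have "(\<Sum>a\<in>#M. card {S \<in> ?F. a \<subseteq> S}) = (\<Sum>S\<in>?F. size {#a \<in># M. a \<subseteq> S#})"
    by (rule double_count_mset[symmetric]) simp
  also have "\<dots> \<le> (\<Sum>S\<in>?F. k - 1)"
  proof (rule sum_mono)
    fix S assume "S \<in> ?F"
    then show "size {#a \<in># M. a \<subseteq> S#} \<le> k - 1"
      using M k s unfolding sparse_def by auto
  qed
  also have "\<dots> = (k - 1) * (m choose s)" by (simp add: n_subsets)
  finally show ?thesis using k by (simp add: of_nat_diff)
qed

section \<open>The construction\<close>

lemma obtain_submultiset_of_size:
  assumes "t \<le> size M"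
  obtains N where "N \<subseteq># M" "size N = t"
proof -
  obtain xs where xs: "mset xs = M" using ex_mset by blast
  have "mset (take t xs) \<subseteq># M"
    by (metis append_take_drop_id mset_append mset_subset_eq_add_left xs)
  moreover have "size (mset (take t xs)) = t" using assms xs by auto
  ultimately show ?thesis using that by blast
qed

text \<open>
  Complementing turns blocks that contain a \<open>t\<close>-set into sets contained in its complement. The points
  are also relabelled as servers; both maps are injective on subsets of \<open>X\<close>, so multiplicities are
  preserved.
\<close>

lemma design_complement:
  fixes X :: "'a set"
  assumes D: "is_design t m b l X D" and c: "\<forall>d\<in>#D. count D d \<le> c"
  obtains E where "\<forall>e\<in>#E. e \<subseteq> {1..m} \<and> card e = m - b"
    and "\<And>e. count E e \<le> c"
    and "\<And>S. S \<subseteq> {1..m} \<Longrightarrow> card S = m - t \<Longrightarrow> t \<le> m \<Longrightarrow> size {#e \<in># E. e \<subseteq> S#} = l"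
proof -
  have X: "finite X" "card X = m" and bl: "\<And>d. d \<in># D \<Longrightarrow> d \<subseteq> X \<and> card d = b"
    and cov: "\<And>T. T \<subseteq> X \<Longrightarrow> card T = t \<Longrightarrow> size {#d \<in># D. T \<subseteq> d#} = l"
    using D unfolding is_design_def by auto
  obtain h where h: "bij_betw h X {1..m}"
    using X by (metis card_atLeastAtMost diff_Suc_1 finite_atLeastAtMost finite_same_card_bij)
  then have inj: "inj_on h X" and img: "h ` X = {1..m}" by (auto simp: bij_betw_def)
  let ?f = "\<lambda>d. {1..m} - h ` d"
  have inv: "{x \<in> X. h x \<notin> ?f d} = d" if "d \<subseteq> X" for d
    using that inj img by (auto dest: inj_onD)
  have injf: "inj_on ?f (Pow X)"
    by (rule inj_on_inverseI[where g = "\<lambda>e. {x \<in> X. h x \<notin> e}"]) (use inv in auto)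
  define E where "E = image_mset ?f D"
  show ?thesis
  proof (rule that)
    show "\<forall>e\<in>#E. e \<subseteq> {1..m} \<and> card e = m - b"
    proof
      fix e assume "e \<in># E"
      then obtain d where d: "d \<in># D" "e = ?f d" unfolding E_def by auto
      have "card (h ` d) = b" using bl[OF d(1)] inj by (metis card_image inj_on_subset)
      moreover have "h ` d \<subseteq> {1..m}" using bl[OF d(1)] img by blast
      ultimately show "e \<subseteq> {1..m} \<and> card e = m - b"
        using d(2) by (auto simp: card_Diff_subset finite_subset)
    qed
    show "count E e \<le> c" for e
    proof (cases "e \<in># E")
      case True
      then obtain d where d: "d \<in># D" "e = ?f d" unfolding E_def by auto
      have "d' = d" if "d' \<in># D" "?f d' = ?f d" for d'
        using that(1) d(1) bl by (intro inj_onD[OF injf that(2)]) auto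
      then have "?f -` {e} \<inter> set_mset D = {d}" using d by auto
      then have "count E e = count D d" unfolding E_def count_image_mset by simp
      then show ?thesis using c d by simp
    qed (simp add: not_in_iff)
    fix S assume S: "S \<subseteq> {1..m}" "card S = m - t" "t \<le> m"
    let ?T = "{x \<in> X. h x \<notin> S}"
    have "h ` ?T = {1..m} - S" using img by auto
    then have "card ?T = card ({1..m} - S)"
      by (metis (no_types, lifting) card_image inj inj_on_subset mem_Collect_eq subsetI)
    also have "\<dots> = t" using S by (simp add: card_Diff_subset finite_subset)
    finally have T: "card ?T = t" .
    have "?f d \<subseteq> S \<longleftrightarrow> ?T \<subseteq> d" if "d \<in># D" for d
    proof -
      have mem: "h x \<in> h ` d \<longleftrightarrow> x \<in> d" if "x \<in> X" for x
        using bl[OF \<open>d \<in># D\<close>] that by (intro inj_on_image_mem_iff[OF inj]) auto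
      have "?f d \<subseteq> S \<longleftrightarrow> (\<forall>x\<in>X. h x \<notin> h ` d \<longrightarrow> h x \<in> S)"
        unfolding img[symmetric] by blast
      then show ?thesis using mem by blast
    qed
    then have "{#d \<in># D. ?f d \<subseteq> S#} = {#d \<in># D. ?T \<subseteq> d#}" by (intro filter_mset_cong) auto
    then show "size {#e \<in># E. e \<subseteq> S#} = l"
      using cov[OF _ T] unfolding E_def by (simp add: filter_mset_image_mset)
  qed
qed

lemma sum_contained_one_below:
  assumes "s < m" and N: "\<forall>a\<in>#N. a \<subseteq> {1..m} \<and> card a + 1 = s"
  shows "(\<Sum>S | S \<subseteq> {1..m} \<and> card S = s. size {#a \<in># N. a \<subseteq> S#}) = size N * (m - s + 1)"
proof -
  let ?F = "{S. S \<subseteq> {1..m} \<and> card S = s}"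
  have "card {S \<in> ?F. a \<subseteq> S} = m - s + 1" if "a \<in># N" for a
  proof -
    have a: "a \<subseteq> {1..m}" "card a + 1 = s" using N that by auto
    then have "s - card a = 1" "m - card a = m - s + 1" using assms(1) by auto
    then show ?thesis using card_supersets_of_card[of "{1..m}" a s] a by simp
  qed
  then have "(\<Sum>a\<in>#N. card {S \<in> ?F. a \<subseteq> S}) = (\<Sum>a\<in>#N. m - s + 1)"
    by (intro arg_cong[of _ _ sum_mset] image_mset_cong) auto
  then show ?thesis using double_count_mset[of ?F "\<lambda>a S. a \<subseteq> S" N] by simp
qed

text \<open>
  In the multiset \<open>P\<close> every \<open>s\<close>-set occurs as often as it can without exceeding the bound \<open>k - 1\<close>
  together with the members of \<open>N\<close> that it contains. Each member of \<open>N\<close> lies in \<open>m - s + 1\<close> of the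
  \<open>s\<close>-sets, so \<open>P\<close> has \<open>(k - 1) (m choose s) - size N (m - s + 1)\<close> members; by the last assumption
  these suffice to fill \<open>N\<close> up to \<open>n\<close> members.
\<close>

lemma sparse_extension:
  assumes k: "k \<ge> 2" and rk: "r + k \<le> m" and s: "s = r + k - 1"
    and N: "\<forall>a\<in>#N. a \<subseteq> {1..m} \<and> card a + 1 = s"
    and mult: "\<And>a. count N a \<le> k - 2"
    and load: "\<And>S. S \<subseteq> {1..m} \<Longrightarrow> card S = s \<Longrightarrow> size {#a \<in># N. a \<subseteq> S#} \<le> k - 1"
    and n: "size N \<le> n" "n + size N * (m - s) \<le> (k - 1) * (m choose s)"
  obtains M where "sparse r k m M" "size M = n" "(\<Sum>a\<in>#M. card a) + size N = s * n"
proof -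
  let ?F = "{S. S \<subseteq> {1..m} \<and> card S = s}"
  let ?load = "\<lambda>S. size {#a \<in># N. a \<subseteq> S#}"
  have sm: "s < m" using rk k s by simp
  define P where "P = (\<Sum>S\<in>?F. replicate_mset (k - 1 - ?load S) S)"
  have cP: "count P S = (if S \<in> ?F then k - 1 - ?load S else 0)" for S
    unfolding P_def count_sum by (simp add: if_distrib sum.delta cong: if_cong)
  have "size P + (\<Sum>S\<in>?F. ?load S) = (\<Sum>S\<in>?F. (k - 1 - ?load S) + ?load S)"
    unfolding P_def by (simp add: sum.distrib)
  also have "\<dots> = (\<Sum>S\<in>?F. k - 1)"
  proof (rule sum.cong)
    fix S assume "S \<in> ?F"
    then show "k - 1 - ?load S + ?load S = k - 1" using load[of S] by simp
  qed simp
  also have "\<dots> = (k - 1) * (m choose s)" by (simp add: n_subsets)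
  finally have "n - size N \<le> size P"
    using n sum_contained_one_below[OF sm N] by (simp add: algebra_simps)
  then obtain Q where Q: "Q \<subseteq># P" "size Q = n - size N" by (rule obtain_submultiset_of_size)
  have cQ: "count Q S \<le> count P S" for S using Q(1) by (rule mset_subset_eq_count)
  have Qs: "a \<subseteq> {1..m} \<and> card a = s" if "a \<in># Q" for a
    using cQ[of a] cP[of a] that by (auto simp flip: count_greater_zero_iff split: if_splits)
  have fin: "finite S" if "S \<subseteq> {1..m}" for S :: "nat set" using that by (rule finite_subset) simp
  \<comment> \<open>A member that fits into a set of its own size equals that set.\<close>
  have level: "size {#a \<in># K. a \<subseteq> S#} = (if card S = c then count K S else 0)"
    if K: "\<forall>a\<in>#K. card a = c" and S: "S \<subseteq> {1..m}" "card S \<le> c" for K :: "nat set multiset" and S c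
  proof -
    have "{#a \<in># K. a \<subseteq> S#} = {#a \<in># K. card S = c \<and> a = S#}"
      using K S fin[OF S(1)] by (intro filter_mset_cong) (auto dest: card_seteq)
    then show ?thesis by (simp add: filter_eq_replicate_mset)
  qed
  have "sparse r k m (N + Q)"
    unfolding sparse_def
  proof (intro conjI allI impI)
    have "a \<subseteq> {1..m}" if "a \<in># N + Q" for a
      using that N Qs[of a] unfolding union_iff by metis
    then show "\<forall>a\<in>#N + Q. a \<subseteq> {1..m}" by blast
    fix i S assume i: "i < k" and S: "S \<subseteq> {1..m}" "card S = r + i"
    have q: "size {#a \<in># Q. a \<subseteq> S#} = (if card S = s then count Q S else 0)"
      using Qs S i s by (intro level) auto
    show "size {#a \<in># N + Q. a \<subseteq> S#} \<le> i"
    proof (cases "card S = s")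
      case True
      then have "count Q S \<le> k - 1 - ?load S" using cQ[of S] cP[of S] S by simp
      then show ?thesis using q True load[OF S(1) True] S s i by simp
    next
      case False
      then have "?load S = (if card S = s - 1 then count N S else 0)"
        using N S i s by (intro level) auto
      moreover have "k - 2 \<le> i" if "card S = s - 1" using that S s k by linarith
      ultimately have "?load S \<le> i" using mult[of S] by (metis le_trans zero_le)
      moreover have "size {#a \<in># Q. a \<subseteq> S#} = 0" using q False by metis
      ultimately show ?thesis unfolding filter_union_mset size_union by linarith
    qed
  qed
  moreover have "size (N + Q) = n" using Q n by simp
  moreover have "(\<Sum>a\<in>#N + Q. card a) + size N = s * n"
  proof -
    have "(\<Sum>a\<in>#N. card a) + size N = (\<Sum>a\<in>#N. card a + 1)"
      by (induction N) auto
    also have "\<dots> = (\<Sum>a\<in>#N. s)" using N by (intro arg_cong[of _ _ sum_mset] image_mset_cong) auto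
    finally have "(\<Sum>a\<in>#N. card a) + size N = size N * s" by simp
    moreover have "(\<Sum>a\<in>#Q. card a) = (\<Sum>a\<in>#Q. s)"
      using Qs by (intro arg_cong[of _ _ sum_mset] image_mset_cong) auto
    ultimately have "(\<Sum>a\<in>#N + Q. card a) + size N = (size N + size Q) * s"
      by (simp add: algebra_simps)
    also have "size N + size Q = n" using Q n by simp
    finally show ?thesis by (simp add: mult.commute)
  qed
  ultimately show ?thesis by (rule that)
qed

section \<open>The minimum weight\<close>

theorem corollary27:
  fixes r k m g n :: nat
    and X :: "'a set" and D :: "'a set multiset"
  assumes "k \<ge> 3" and "m \<ge> r + k" and "g = m - (r + k)"
    and "is_design (g + 1) m (g + 2) (k - 1) X D"
    and "\<forall>b\<in>#D. count D b \<le> k - 2"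
    and "(real k - 1) / (real r + real k - 1) * real (m choose (r + k - 2)) \<le> real n"
    and "real n \<le> (real k - 1) * real (m choose (r + k - 1))"
  shows "int (ECBC_min_weight n k m r) =
    (int r + int k - 1) * int n -
    \<lfloor>((real k - 1) * real (m choose (r + k - 1)) - real n) / (real m - real r - real k + 1)\<rfloor>"
proof -
  define s where "s = r + k - 1"
  define G where "G = m - s"
  define c where "c = (k - 1) * (m choose s)"
  define t where "t = (c - n) div G"
  have s: "s \<ge> 2" "s < m" "s - 1 = r + k - 2" using assms(1,2) by (auto simp: s_def)
  have G: "G \<ge> 1" "g + 1 = G" "real m - real r - real k + 1 = real G"
    "int m - int s = int G"
    using assms(1-3) by (auto simp: s_def G_def)
  have rc: "(real k - 1) * real (m choose (r + k - 1)) = real c"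
    using assms(1) by (simp add: c_def s_def of_nat_diff)
  have rs: "real r + real k - 1 = real s" using assms(1) by (simp add: s_def of_nat_diff)
  have nc: "n \<le> c" using assms(7) rc by simp
  obtain E where E: "\<forall>e\<in>#E. e \<subseteq> {1..m} \<and> card e = m - (g + 2)"
      "\<And>e. count E e \<le> k - 2"
      "\<And>S. S \<subseteq> {1..m} \<Longrightarrow> card S = m - (g + 1) \<Longrightarrow> g + 1 \<le> m \<Longrightarrow> size {#e \<in># E. e \<subseteq> S#} = k - 1"
    using design_complement[OF assms(4,5)] by metis
  have E1: "\<forall>e\<in>#E. e \<subseteq> {1..m} \<and> card e + 1 = s" using E(1) s G by (auto simp: G_def)
  have E3: "size {#e \<in># E. e \<subseteq> S#} = k - 1" if "S \<subseteq> {1..m}" "card S = s" for S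
    using E(3)[OF that(1)] that(2) s G by (simp add: G_def)
  have "size E * (G + 1) = (\<Sum>S | S \<subseteq> {1..m} \<and> card S = s. size {#e \<in># E. e \<subseteq> S#})"
    using sum_contained_one_below[OF s(2) E1] by (simp add: G_def)
  also have "\<dots> = (\<Sum>S | S \<subseteq> {1..m} \<and> card S = s. k - 1)" using E3 by (intro sum.cong) auto
  also have "\<dots> = c" by (simp add: n_subsets c_def)
  finally have sizeE: "size E * (G + 1) = c" .
  \<comment> \<open>The hypothesis that bounds \<open>n\<close> from below is stated with \<open>m choose (s - 1)\<close>; absorption shows
    that it compares \<open>n\<close> with the number of blocks.\<close>
  have "m - (s - 1) = G + 1" using s by (simp add: G_def)
  then have absorb: "s * (m choose s) = (G + 1) * (m choose (s - 1))"
    using binomial_absorb_comp[of m "s - 1"] times_binomial_minus1_eq[of s m] s(1)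
    by simp
  have "s * c = (G + 1) * ((k - 1) * (m choose (s - 1)))"
    using absorb by (simp add: c_def algebra_simps)
  then have "(G + 1) * (s * size E) = (G + 1) * ((k - 1) * (m choose (s - 1)))"
    by (simp only: sizeE[symmetric] ac_simps)
  then have "s * size E = (k - 1) * (m choose (s - 1))" by (simp only: mult_cancel1) simp
  moreover have "(k - 1) * (m choose (s - 1)) \<le> s * n"
  proof -
    have "real ((k - 1) * (m choose (s - 1))) \<le> real (s * n)"
      using assms(6)[unfolded rs] s(1,3) assms(1) by (simp add: of_nat_diff field_simps)
    then show ?thesis by linarith
  qed
  ultimately have "s * size E \<le> s * n" by simp
  then have En: "size E \<le> n" using s(1) by simp
  have tG: "t * G \<le> c - n" unfolding t_def by simp
  also have "c - n \<le> size E * G" using sizeE En by (simp add: algebra_simps)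
  finally have tE: "t \<le> size E" using G by simp
  obtain N where N: "N \<subseteq># E" "size N = t" using tE by (rule obtain_submultiset_of_size)
  have N3: "size {#e \<in># N. e \<subseteq> S#} \<le> k - 1" if "S \<subseteq> {1..m}" "card S = s" for S
    using E3[OF that] size_mset_mono[OF multiset_filter_mono[OF N(1)]] by metis
  obtain M where M: "sparse r k m M" "size M = n" "(\<Sum>a\<in>#M. card a) + size N = s * n"
  proof (rule sparse_extension[of k r m s N n])
    show "\<forall>a\<in>#N. a \<subseteq> {1..m} \<and> card a + 1 = s" using E1 N(1) by (meson mset_subset_eqD)
    show "count N a \<le> k - 2" for a using E(2) mset_subset_eq_count[OF N(1)] le_trans by blast
    show "size N \<le> n" using N tE En by simp
    show "n + size N * (m - s) \<le> (k - 1) * (m choose s)"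
      using tG nc N by (simp add: G_def c_def)
  qed (use assms(1,2) s_def N3 in auto)
  have "t \<le> s * n" using M(3) N(2) by simp
  have "ECBC_min_weight n k m r = s * n - t"
    unfolding ECBC_min_weight_def ECBC_iff_sparse[OF assms(2)]
  proof (rule Least_equality)
    show "\<exists>M. sparse r k m M \<and> size M = n \<and> (\<Sum>a\<in>#M. card a) = s * n - t"
      using M N by (intro exI[of _ M]) simp
    fix w assume "\<exists>M. sparse r k m M \<and> size M = n \<and> (\<Sum>a\<in>#M. card a) = w"
    then obtain M where M: "sparse r k m M" "size M = n" "(\<Sum>a\<in>#M. card a) = w" by blast
    have "int n + int G * (int s * int n - int w) \<le> int c"
      using sparse_weight_bound[OF M(1) _ assms(2) s_def] M(2,3) G(4) assms(1)
      by (simp add: c_def of_nat_diff)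
    then have "(int s * int n - int w) * int G \<le> int (c - n)"
      using nc by (simp add: of_nat_diff mult.commute)
    then have "int s * int n - int w \<le> int (c - n) div int G"
      using G(1) zdiv_mono1[of "(int s * int n - int w) * int G" _ "int G"] by simp
    then have "int s * int n - int w \<le> int t" by (simp add: t_def zdiv_int)
    then have "s * n \<le> w + t" by (simp flip: of_nat_mult of_nat_add)
    then show "s * n - t \<le> w" by simp
  qed
  then have "int (ECBC_min_weight n k m r) = int s * int n - int t"
    using \<open>t \<le> s * n\<close> by (simp add: of_nat_diff)
  moreover have "\<lfloor>((real k - 1) * real (m choose (r + k - 1)) - real n) / (real m - real r - real k + 1)\<rfloor> = int t"
    unfolding rc G(3) t_def using nc floor_divide_of_nat_eq[of "c - n" G] by (simp add: of_nat_diff)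
  moreover have "int s = int r + int k - 1" using assms(1) by (simp add: s_def of_nat_diff)
  ultimately show ?thesis by simp
qed

end
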